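(* Let $B$ be a two-sided skew brace and $A$ a sub skew brace of $B$ of finite index. Then there exists an ideal $I$ of $B$ of finite index contained in $A$.
   Context: A skew brace is a triple $(B,+,\circ)$ where $(B,+)$ and $(B,\circ)$ are (not necessarily abelian) groups with $a\circ(b+c)=a\circ b-a+a\circ c$ for all $a,b,c\in B$, where $-a$ is the inverse of $a$ in $(B,+)$ and $\circ$ takes precedence over $+$. It is two-sided if also $(c+b)\circ a=c\circ a-a+b\circ a$ for all $a,b,c\in B$. Put $\lambda_a(b)=-a+a\circ b$; each $\lambda_a$ is an automorphism of $(B,+)$. A sub skew brace is a subset that is a subgroup of both $(B,+)$ and $(B,\circ)$. An ideal is a subgroup $I$ of $(B,+)$ with $\lambda_b(I)=I$ for all $b\in B$ that is normal in both $(B,+)$ and $(B,\circ)$. A sub skew brace $C$ has finite index in $B$ if there is a positive integer $n$ such that the index of $(C,+)$ in $(B,+)$ and the index of $(C,\circ)$ in $(B,\circ)$ are both equal to $n$. *)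

theory Defs
  imports "HOL-Algebra.Coset" "HOL-Algebra.Ring"
begin

text \<open>
  A skew brace is carried by a ring record: \<open>\<oplus>\<close>, \<open>\<ominus>\<close> and \<open>\<zero>\<close> belong to the additive
  group \<open>add_monoid B\<close>, which need not be abelian, and \<open>\<otimes>\<close> is the circle operation, so
  the circle group is \<open>B\<close> itself read as a monoid record. Here \<open>a \<ominus> b\<close> is \<open>a \<oplus> (\<ominus> b)\<close>,
  and sums associate to the left. Only the record is borrowed from rings, no ring axioms.
\<close>

locale skew_brace =
  add: group "add_monoid B" + circ: group B
  for B :: "('a, 'm) ring_scheme" (structure) +
  assumes left_distrib:
    "\<lbrakk>a \<in> carrier B; b \<in> carrier B; c \<in> carrier B\<rbrakk>
      \<Longrightarrow> a \<otimes> (b \<oplus> c) = a \<otimes> b \<ominus> a \<oplus> a \<otimes> c"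

locale two_sided_skew_brace = skew_brace +
  assumes right_distrib:
    "\<lbrakk>a \<in> carrier B; b \<in> carrier B; c \<in> carrier B\<rbrakk>
      \<Longrightarrow> (c \<oplus> b) \<otimes> a = c \<otimes> a \<ominus> a \<oplus> b \<otimes> a"

definition brace_lambda :: "('a, 'm) ring_scheme \<Rightarrow> 'a \<Rightarrow> 'a \<Rightarrow> 'a" where
  "brace_lambda B a b = (\<ominus>\<^bsub>B\<^esub> a) \<oplus>\<^bsub>B\<^esub> a \<otimes>\<^bsub>B\<^esub> b"

definition sub_skew_brace :: "'a set \<Rightarrow> ('a, 'm) ring_scheme \<Rightarrow> bool" where
  "sub_skew_brace C B \<longleftrightarrow> subgroup C (add_monoid B) \<and> subgroup C B"

definition brace_ideal :: "'a set \<Rightarrow> ('a, 'm) ring_scheme \<Rightarrow> bool" where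
  "brace_ideal I B \<longleftrightarrow>
     subgroup I (add_monoid B) \<and>
     (\<forall>b \<in> carrier B. brace_lambda B b ` I = I) \<and>
     I \<lhd> add_monoid B \<and> I \<lhd> B"

text \<open>
  An infinite set has \<open>card\<close> equal to \<open>0\<close>, so \<open>n > 0\<close> is what makes both indices finite.
\<close>

definition finite_index :: "'a set \<Rightarrow> ('a, 'm) ring_scheme \<Rightarrow> bool" where
  "finite_index C B \<longleftrightarrow>
     (\<exists>n::nat. n > 0 \<and> card (rcosets\<^bsub>add_monoid B\<^esub> C) = n \<and> card (rcosets\<^bsub>B\<^esub> C) = n)"

end

theory Submission
  imports Defs
begin

text \<open>
  In a two-sided skew brace both kinds of circle translation are affine over the additive group:
  \<open>a \<otimes> x = a \<oplus> \<lambda>\<^sub>a x\<close> and \<open>x \<otimes> b = \<rho>\<^sub>b x \<oplus> b\<close> with \<open>\<lambda>\<^sub>a\<close> and \<open>\<rho>\<^sub>b\<close> additive automorphisms.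
  An ideal is therefore the same thing as an additive subgroup that is stable under all
  \<open>\<lambda>\<^sub>a\<close>, all \<open>\<rho>\<^sub>b\<close> and all inner automorphisms of the additive group. The largest ideal inside
  \<open>A\<close> is cut out by the conditions \<open>\<phi> y \<in> A\<close>, where \<open>\<phi>\<close> runs through the group generated by these
  automorphisms, and the point is that finitely many of these conditions imply the others.

  Since left and right circle translations commute, \<open>\<lambda>\<^sub>a\<close> and \<open>\<rho>\<^sub>b\<close> commute up to an inner
  automorphism (\<open>rho_lam\<close>). As automorphisms normalise the inner ones, every \<open>\<phi>\<close> has the form
  (inner) \<open>\<circ> \<rho>\<^sub>b \<circ> \<lambda>\<^sub>a\<close>, and the three factors can be reordered at the cost of changing the inner
  one. Now write \<open>a = a' \<otimes> s\<close> and \<open>b = t \<otimes> b'\<close> with \<open>a', b' \<in> A\<close>, where \<open>s\<close> and \<open>t\<close> come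
  from finite transversals of \<open>A\<close> in the circle group. Then \<open>\<lambda>\<^sub>a = \<lambda>\<^sub>a\<^sub>' \<lambda>\<^sub>s\<close> and
  \<open>\<rho>\<^sub>b = \<rho>\<^sub>b\<^sub>' \<rho>\<^sub>t\<close>; after moving \<open>\<lambda>\<^sub>a\<^sub>'\<close> and \<open>\<rho>\<^sub>b\<^sub>'\<close> to the outside they disappear from the
  condition, because they map \<open>A\<close> into itself. The conjugating element matters only modulo \<open>A\<close>
  as well. What remains is a finite intersection of preimages of \<open>A\<close> under additive
  automorphisms (\<open>brace_core_finite_conditions\<close>), and this has finite additive index.

  Finally, an ideal has the same cosets in both groups, so its two indices agree.
\<close>

section \<open>Subgroups of finite index\<close>

lemma (in group) finite_transversal:
  assumes H: "subgroup H G" and fin: "finite (rcosets H)"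
  obtains S where "finite S" "S \<subseteq> carrier G"
    "\<And>a. a \<in> carrier G \<Longrightarrow> \<exists>h\<in>H. \<exists>s\<in>S. a = h \<otimes> s"
proof -
  define pick where "pick C = (SOME s. s \<in> carrier G \<and> C = H #> s)" for C
  have pick: "pick C \<in> carrier G \<and> C = H #> pick C" if "C \<in> rcosets H" for C
  proof -
    have "\<exists>s. s \<in> carrier G \<and> C = H #> s"
      using that by (auto simp: RCOSETS_def)
    then show ?thesis
      unfolding pick_def by (rule someI_ex)
  qed
  have "\<exists>h\<in>H. \<exists>s\<in>pick ` (rcosets H). a = h \<otimes> s" if a: "a \<in> carrier G" for a
  proof -
    have C: "H #> a \<in> rcosets H"
      using a by (auto simp: RCOSETS_def)
    then have "H #> a = H #> pick (H #> a)"
      using pick by blast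
    moreover have "a \<in> H #> a"
      by (rule rcos_self[OF a H])
    ultimately have "a \<in> H #> pick (H #> a)"
      by simp
    then show ?thesis
      using C by (auto simp: r_coset_def)
  qed
  moreover have "finite (pick ` (rcosets H))" "pick ` (rcosets H) \<subseteq> carrier G"
    using fin pick by auto
  ultimately show thesis
    using that by blast
qed

text \<open>
  The coset of \<open>y\<close> modulo the intersection of the preimages is determined by the family of cosets
  of the images of \<open>y\<close>, and there are finitely many such families.
\<close>

lemma (in group) finite_rcosets_INT_vimage:
  assumes H: "subgroup H G" and fin: "finite (rcosets H)" and K: "finite K"
    and hom: "\<And>k. k \<in> K \<Longrightarrow> \<phi> k \<in> hom G G"
    and I: "I = {y \<in> carrier G. \<forall>k\<in>K. \<phi> k y \<in> H}" and sub: "subgroup I G"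
  shows "finite (rcosets I)"
proof -
  define \<Phi> where "\<Phi> y = (\<lambda>k\<in>K. H #> \<phi> k y)" for y
  have cl: "\<phi> k y \<in> carrier G" if "k \<in> K" "y \<in> carrier G" for k y
    using hom that by (auto simp: hom_def)
  have "\<Phi> ` carrier G \<subseteq> K \<rightarrow>\<^sub>E rcosets H"
    using cl subgroup.subset[OF H] by (auto simp: \<Phi>_def intro!: rcosetsI)
  then have fin_img: "finite (\<Phi> ` carrier G)"
    using finite_PiE[OF K, of "\<lambda>_. rcosets H"] fin finite_subset by blast
  have same: "I #> x = I #> y"
    if xy: "x \<in> carrier G" "y \<in> carrier G" and eq: "\<Phi> x = \<Phi> y" for x y
  proof -
    have "\<phi> k (x \<otimes> inv y) \<in> H" if k: "k \<in> K" for k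
    proof -
      interpret k: group_hom G G "\<phi> k"
        by unfold_locales (rule hom[OF k])
      have "H #> \<phi> k x = H #> \<phi> k y"
        using fun_cong[OF eq, of k] k by (simp add: \<Phi>_def)
      moreover have "\<phi> k x \<in> H #> \<phi> k x"
        by (rule rcos_self[OF cl[OF k xy(1)] H])
      ultimately obtain h where h: "h \<in> H" "\<phi> k x = h \<otimes> \<phi> k y"
        by (auto simp: r_coset_def)
      have "\<phi> k x \<otimes> inv (\<phi> k y) = h"
        using h subgroup.mem_carrier[OF H h(1)] cl[OF k xy(2)] by (simp add: m_assoc)
      then show ?thesis
        using h(1) xy by simp
    qed
    then have "x \<otimes> inv y \<in> I"
      using xy by (simp add: I)
    then have "x \<in> I #> y"
      using xy by (auto simp: r_coset_def m_assoc intro!: bexI[of _ "x \<otimes> inv y"])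
    then show ?thesis
      using repr_independence[OF _ xy(2) sub] by simp
  qed
  define rep where "rep f = (SOME y. y \<in> carrier G \<and> \<Phi> y = f)" for f
  have "rcosets I \<subseteq> (\<lambda>f. I #> rep f) ` \<Phi> ` carrier G"
  proof
    fix C assume "C \<in> rcosets I"
    then obtain x where x: "x \<in> carrier G" "C = I #> x"
      by (auto simp: RCOSETS_def)
    have "rep (\<Phi> x) \<in> carrier G \<and> \<Phi> (rep (\<Phi> x)) = \<Phi> x"
      unfolding rep_def by (rule someI[of _ x]) (simp add: x)
    then have "C = I #> rep (\<Phi> x)"
      using same[of x "rep (\<Phi> x)"] x by metis
    then show "C \<in> (\<lambda>f. I #> rep f) ` \<Phi> ` carrier G"
      using x by blast
  qed
  then show ?thesis
    using fin_img finite_subset by blast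
qed

section \<open>The additive automorphisms of a two-sided skew brace\<close>

context two_sided_skew_brace
begin

lemma neg_closed [simp]: "x \<in> carrier B \<Longrightarrow> \<ominus> x \<in> carrier B"
  using add.inv_closed by (simp add: a_inv_def)

lemma sum_closed [simp]: "x \<in> carrier B \<Longrightarrow> y \<in> carrier B \<Longrightarrow> x \<oplus> y \<in> carrier B"
  using add.m_closed by simp

lemma zero_mem [simp]: "\<zero> \<in> carrier B"
  using add.one_closed by simp

lemma sum_assoc:
  "x \<in> carrier B \<Longrightarrow> y \<in> carrier B \<Longrightarrow> z \<in> carrier B \<Longrightarrow> x \<oplus> y \<oplus> z = x \<oplus> (y \<oplus> z)"
  using add.m_assoc by simp

lemma neg_simps [simp]:
  "x \<in> carrier B \<Longrightarrow> \<ominus> x \<oplus> x = \<zero>"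
  "x \<in> carrier B \<Longrightarrow> x \<oplus> \<ominus> x = \<zero>"
  "x \<in> carrier B \<Longrightarrow> \<zero> \<oplus> x = x"
  "x \<in> carrier B \<Longrightarrow> x \<oplus> \<zero> = x"
  "x \<in> carrier B \<Longrightarrow> \<ominus> (\<ominus> x) = x"
  using add.l_inv add.r_inv add.l_one add.r_one add.inv_inv by (simp_all add: a_inv_def)

lemma neg_sum: "x \<in> carrier B \<Longrightarrow> y \<in> carrier B \<Longrightarrow> \<ominus> (x \<oplus> y) = \<ominus> y \<oplus> \<ominus> x"
  using add.inv_mult_group by (simp add: a_inv_def)

lemma neg_cancel [simp]:
  assumes "x \<in> carrier B" "y \<in> carrier B"
  shows "\<ominus> x \<oplus> (x \<oplus> y) = y" "x \<oplus> (\<ominus> x \<oplus> y) = y"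
  using assms by (simp_all flip: sum_assoc)

lemma sum_left_cancel:
  "x \<in> carrier B \<Longrightarrow> y \<in> carrier B \<Longrightarrow> z \<in> carrier B \<Longrightarrow> x \<oplus> y = x \<oplus> z \<longleftrightarrow> y = z"
  using neg_cancel(1)[of x y] neg_cancel(1)[of x z] by metis

lemma sum_right_cancel:
  "x \<in> carrier B \<Longrightarrow> y \<in> carrier B \<Longrightarrow> z \<in> carrier B \<Longrightarrow> y \<oplus> x = z \<oplus> x \<longleftrightarrow> y = z"
  using add.right_cancel by simp

lemmas group_word = sum_assoc neg_sum a_minus_def

abbreviation lam :: "'a \<Rightarrow> 'a \<Rightarrow> 'a" where
  "lam \<equiv> brace_lambda B"

definition rho :: "'a \<Rightarrow> 'a \<Rightarrow> 'a" where
  "rho b x = x \<otimes> b \<ominus> b"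

definition inner :: "'a \<Rightarrow> 'a \<Rightarrow> 'a" where
  "inner z x = z \<oplus> x \<ominus> z"

lemma lam_closed [simp]: "a \<in> carrier B \<Longrightarrow> x \<in> carrier B \<Longrightarrow> lam a x \<in> carrier B"
  by (simp add: brace_lambda_def)

lemma rho_closed [simp]: "b \<in> carrier B \<Longrightarrow> x \<in> carrier B \<Longrightarrow> rho b x \<in> carrier B"
  by (simp add: rho_def a_minus_def)

lemma inner_closed [simp]: "z \<in> carrier B \<Longrightarrow> x \<in> carrier B \<Longrightarrow> inner z x \<in> carrier B"
  by (simp add: inner_def a_minus_def)

lemma circ_eq_lam: "a \<in> carrier B \<Longrightarrow> x \<in> carrier B \<Longrightarrow> a \<otimes> x = a \<oplus> lam a x"
  by (simp add: brace_lambda_def)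

lemma circ_eq_rho: "b \<in> carrier B \<Longrightarrow> x \<in> carrier B \<Longrightarrow> x \<otimes> b = rho b x \<oplus> b"
  by (simp add: rho_def group_word)

lemma lam_sum:
  assumes "a \<in> carrier B" "x \<in> carrier B" "y \<in> carrier B"
  shows "lam a (x \<oplus> y) = lam a x \<oplus> lam a y"
  using assms by (simp add: brace_lambda_def left_distrib group_word)

lemma rho_sum:
  assumes "b \<in> carrier B" "x \<in> carrier B" "y \<in> carrier B"
  shows "rho b (x \<oplus> y) = rho b x \<oplus> rho b y"
  using assms by (simp add: rho_def right_distrib group_word)

lemma inner_sum:
  assumes "z \<in> carrier B" "x \<in> carrier B" "y \<in> carrier B"
  shows "inner z (x \<oplus> y) = inner z x \<oplus> inner z y"
  using assms by (simp add: inner_def group_word)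

lemma additive_hom:
  assumes "\<And>x. x \<in> carrier B \<Longrightarrow> f x \<in> carrier B"
    and "\<And>x y. x \<in> carrier B \<Longrightarrow> y \<in> carrier B \<Longrightarrow> f (x \<oplus> y) = f x \<oplus> f y"
  shows "group_hom (add_monoid B) (add_monoid B) f"
  using assms by unfold_locales (auto simp: hom_def)

lemma additive_neg:
  assumes "\<And>x. x \<in> carrier B \<Longrightarrow> f x \<in> carrier B"
    and "\<And>x y. x \<in> carrier B \<Longrightarrow> y \<in> carrier B \<Longrightarrow> f (x \<oplus> y) = f x \<oplus> f y"
    and "x \<in> carrier B"
  shows "f (\<ominus> x) = \<ominus> (f x)"
  using group_hom.hom_inv[OF additive_hom[of f, OF assms(1,2)]] assms(3) by (simp add: a_inv_def)

lemma additive_inner: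
  assumes "\<And>x. x \<in> carrier B \<Longrightarrow> f x \<in> carrier B"
    and "\<And>x y. x \<in> carrier B \<Longrightarrow> y \<in> carrier B \<Longrightarrow> f (x \<oplus> y) = f x \<oplus> f y"
    and "z \<in> carrier B" "x \<in> carrier B"
  shows "f (inner z x) = inner (f z) (f x)"
  using assms(3,4) by (simp add: inner_def a_minus_def assms(1,2) additive_neg[of f, OF assms(1,2)])

lemma lam_inner:
  "a \<in> carrier B \<Longrightarrow> z \<in> carrier B \<Longrightarrow> x \<in> carrier B \<Longrightarrow> lam a (inner z x) = inner (lam a z) (lam a x)"
  by (rule additive_inner) (simp_all add: lam_sum)

lemma rho_inner:
  "b \<in> carrier B \<Longrightarrow> z \<in> carrier B \<Longrightarrow> x \<in> carrier B \<Longrightarrow> rho b (inner z x) = inner (rho b z) (rho b x)"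
  by (rule additive_inner) (simp_all add: rho_sum)

lemma inner_comp:
  "w \<in> carrier B \<Longrightarrow> z \<in> carrier B \<Longrightarrow> x \<in> carrier B \<Longrightarrow> inner w (inner z x) = inner (w \<oplus> z) x"
  by (simp add: inner_def group_word)

lemma inner_zero [simp]: "x \<in> carrier B \<Longrightarrow> inner \<zero> x = x"
  using add.inv_one by (simp add: inner_def a_minus_def a_inv_def)

lemma inner_neg_cancel [simp]:
  assumes "z \<in> carrier B" "x \<in> carrier B"
  shows "inner (\<ominus> z) (inner z x) = x" "inner z (inner (\<ominus> z) x) = x"
  using assms by (simp_all add: inner_comp)

text \<open>
  Taking linear parts of affine maps is multiplicative; left circle translations compose in the
  order of the circle product, right ones in the opposite order.
\<close>

lemma lam_circ:
  assumes "a \<in> carrier B" "b \<in> carrier B" "x \<in> carrier B"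
  shows "lam (a \<otimes> b) x = lam a (lam b x)"
proof -
  have "a \<otimes> b \<oplus> lam (a \<otimes> b) x = a \<otimes> (b \<oplus> lam b x)"
    using assms by (simp add: circ.m_assoc flip: circ_eq_lam)
  also have "\<dots> = a \<otimes> b \<oplus> lam a (lam b x)"
    using assms by (simp add: circ_eq_lam lam_sum sum_assoc)
  finally show ?thesis
    using assms by (simp add: sum_left_cancel)
qed

lemma rho_circ:
  assumes "a \<in> carrier B" "b \<in> carrier B" "x \<in> carrier B"
  shows "rho (a \<otimes> b) x = rho b (rho a x)"
proof -
  have "rho (a \<otimes> b) x \<oplus> a \<otimes> b = (rho a x \<oplus> a) \<otimes> b"
    using assms by (simp add: circ.m_assoc flip: circ_eq_rho)
  also have "\<dots> = rho b (rho a x) \<oplus> (rho b a \<oplus> b)"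
    using assms circ_eq_rho[of b "rho a x \<oplus> a"] by (simp add: rho_sum sum_assoc)
  also have "\<dots> = rho b (rho a x) \<oplus> a \<otimes> b"
    using assms by (simp flip: circ_eq_rho)
  finally show ?thesis
    using assms by (simp add: sum_right_cancel)
qed

lemma lam_one [simp]: "x \<in> carrier B \<Longrightarrow> lam \<one> x = x"
proof -
  assume x: "x \<in> carrier B"
  have "lam \<one> (lam \<one> x) = lam \<one> x"
    using lam_circ[of \<one> \<one> x] x by simp
  moreover have "\<one> \<oplus> lam \<one> (lam \<one> x) = lam \<one> x"
    using circ_eq_lam[of \<one> "lam \<one> x"] x by simp
  moreover have "\<one> \<oplus> lam \<one> x = x"
    using circ_eq_lam[of \<one> x] x by simp
  ultimately show ?thesis by simp
qed

lemma one_eq_zero: "\<one> = \<zero>"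
  using circ_eq_lam[of \<one> \<zero>] by simp

lemma rho_one [simp]:
  assumes "x \<in> carrier B"
  shows "rho \<one> x = x"
proof -
  have "rho \<one> x = rho \<one> x \<oplus> \<one>"
    using assms circ.one_closed by (simp add: one_eq_zero)
  also have "\<dots> = x"
    using assms by (simp flip: circ_eq_rho)
  finally show ?thesis .
qed

lemma lam_inv_cancel [simp]:
  assumes "a \<in> carrier B" "x \<in> carrier B"
  shows "lam (inv a) (lam a x) = x" "lam a (lam (inv a) x) = x"
  using assms by (simp_all flip: lam_circ)

lemma rho_inv_cancel [simp]:
  assumes "a \<in> carrier B" "x \<in> carrier B"
  shows "rho (inv a) (rho a x) = x" "rho a (rho (inv a) x) = x"
  using assms by (simp_all flip: rho_circ)

text \<open>
  Compare the linear parts of the two sides of \<open>(a \<otimes> x) \<otimes> b = a \<otimes> (x \<otimes> b)\<close>: they agree up to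
  moving the translation part past them.
\<close>

lemma inner_rho_lam:
  assumes [simp]: "a \<in> carrier B" "b \<in> carrier B" "x \<in> carrier B"
  shows "inner (rho b a) (rho b (lam a x)) = inner a (lam a (rho b x))"
proof -
  have "rho b a \<oplus> rho b (lam a x) \<oplus> b = (a \<otimes> x) \<otimes> b"
    using circ_eq_rho[of b "a \<oplus> lam a x"] circ_eq_lam[of a x] by (simp add: rho_sum)
  also have "\<dots> = a \<otimes> (x \<otimes> b)"
    by (simp add: circ.m_assoc)
  also have "\<dots> = a \<oplus> lam a (rho b x) \<oplus> lam a b"
    using circ_eq_lam[of a "rho b x \<oplus> b"] circ_eq_rho[of b x] by (simp add: lam_sum sum_assoc)
  finally have 1: "rho b a \<oplus> rho b (lam a x) \<oplus> b = a \<oplus> lam a (rho b x) \<oplus> lam a b" .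
  have "rho b a \<oplus> b = a \<oplus> lam a b"
    using circ_eq_rho[of b a] circ_eq_lam[of a b] by simp
  then have 2: "b = \<ominus> (rho b a) \<oplus> (a \<oplus> lam a b)"
    by (metis assms(1,2) neg_cancel(1) rho_closed)
  have "rho b a \<oplus> rho b (lam a x) \<oplus> (\<ominus> (rho b a) \<oplus> (a \<oplus> lam a b))
      = a \<oplus> lam a (rho b x) \<oplus> lam a b"
    using 1 2 by simp
  then have "(rho b a \<oplus> rho b (lam a x) \<oplus> \<ominus> (rho b a)) \<oplus> (a \<oplus> lam a b)
      = (a \<oplus> lam a (rho b x) \<oplus> \<ominus> a) \<oplus> (a \<oplus> lam a b)"
    by (simp add: sum_assoc)
  then show ?thesis
    by (simp add: inner_def a_minus_def sum_right_cancel)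
qed

lemma rho_lam:
  assumes "a \<in> carrier B" "b \<in> carrier B" "x \<in> carrier B"
  shows "rho b (lam a x) = inner (\<ominus> (rho b a) \<oplus> a) (lam a (rho b x))"
proof -
  have "rho b (lam a x) = inner (\<ominus> (rho b a)) (inner (rho b a) (rho b (lam a x)))"
    using assms by simp
  also have "\<dots> = inner (\<ominus> (rho b a) \<oplus> a) (lam a (rho b x))"
    using assms by (simp add: inner_rho_lam inner_comp)
  finally show ?thesis .
qed

section \<open>Ideals\<close>

text \<open>
  For a subgroup stable under these automorphisms, \<open>I \<otimes> b = \<rho>\<^sub>b I \<oplus> b = I \<oplus> b\<close> and
  \<open>b \<otimes> I = b \<oplus> \<lambda>\<^sub>b I = b \<oplus> I\<close>. Additive normality thus gives circle normality, and both
  groups have the same cosets of \<open>I\<close>. Stability as an inclusion suffices, since the inverse of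
  \<open>\<lambda>\<^sub>b\<close> is the map \<open>\<lambda>\<close> of the circle inverse of \<open>b\<close>, and likewise for \<open>\<rho>\<^sub>b\<close>.
\<close>

lemma brace_idealI:
  assumes sub: "subgroup I (add_monoid B)"
    and lam: "\<And>a y. a \<in> carrier B \<Longrightarrow> y \<in> I \<Longrightarrow> lam a y \<in> I"
    and rho: "\<And>b y. b \<in> carrier B \<Longrightarrow> y \<in> I \<Longrightarrow> rho b y \<in> I"
    and inner: "\<And>z y. z \<in> carrier B \<Longrightarrow> y \<in> I \<Longrightarrow> inner z y \<in> I"
  shows "brace_ideal I B" and "rcosets\<^bsub>add_monoid B\<^esub> I = rcosets I"
proof -
  have car [simp]: "y \<in> carrier B" if "y \<in> I" for y
    using subgroup.mem_carrier[OF sub that] by simp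
  have I_sum: "x \<oplus> y \<in> I" if "x \<in> I" "y \<in> I" for x y
    using subgroup.m_closed[OF sub that] by simp
  have I_neg: "\<ominus> x \<in> I" if "x \<in> I" for x
    using subgroup.m_inv_closed[OF sub that] by (simp add: a_inv_def)
  have I_zero: "\<zero> \<in> I"
    using subgroup.one_closed[OF sub] by simp
  have add_normal: "I \<lhd> add_monoid B"
    unfolding add.normal_inv_iff using sub inner
    by (simp add: inner_def a_minus_def a_inv_def)
  have rcos: "I #> b = I #>\<^bsub>add_monoid B\<^esub> b" if b: "b \<in> carrier B" for b
  proof
    show "I #> b \<subseteq> I #>\<^bsub>add_monoid B\<^esub> b"
      using b rho by (auto simp: r_coset_def circ_eq_rho)
    show "I #>\<^bsub>add_monoid B\<^esub> b \<subseteq> I #> b"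
    proof
      fix u assume "u \<in> I #>\<^bsub>add_monoid B\<^esub> b"
      then obtain y where y: "y \<in> I" "u = y \<oplus> b"
        by (auto simp: r_coset_def)
      then have "u = rho (inv b) y \<otimes> b" "rho (inv b) y \<in> I"
        using b rho by (simp_all add: circ_eq_rho)
      then show "u \<in> I #> b"
        by (auto simp: r_coset_def)
    qed
  qed
  have lcos: "b <# I = b <#\<^bsub>add_monoid B\<^esub> I" if b: "b \<in> carrier B" for b
  proof
    show "b <# I \<subseteq> b <#\<^bsub>add_monoid B\<^esub> I"
      using b lam by (auto simp: l_coset_def circ_eq_lam)
    show "b <#\<^bsub>add_monoid B\<^esub> I \<subseteq> b <# I"
    proof
      fix u assume "u \<in> b <#\<^bsub>add_monoid B\<^esub> I"
      then obtain y where y: "y \<in> I" "u = b \<oplus> y"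
        by (auto simp: l_coset_def)
      then have "u = b \<otimes> lam (inv b) y" "lam (inv b) y \<in> I"
        using b lam by (simp_all add: circ_eq_lam)
      then show "u \<in> b <# I"
        by (auto simp: l_coset_def)
    qed
  qed
  have circ_sub: "subgroup I B"
  proof (rule circ.subgroupI)
    show "I \<subseteq> carrier B" "I \<noteq> {}"
      using car I_zero by auto
    show "x \<otimes> y \<in> I" if "x \<in> I" "y \<in> I" for x y
      using that lam I_sum by (simp add: circ_eq_lam)
    show "inv x \<in> I" if x: "x \<in> I" for x
    proof -
      \<comment> \<open>the neutral elements coincide, so a circle inverse is the negative of an image of \<open>x\<close>\<close>
      have "inv x \<oplus> lam (inv x) x = \<zero>"
        using x circ_eq_lam[of "inv x" x] by (simp add: one_eq_zero)
      then have "inv x \<oplus> lam (inv x) x \<oplus> \<ominus> (lam (inv x) x) = \<ominus> (lam (inv x) x)"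
        using x by simp
      then have eq: "inv x = \<ominus> (lam (inv x) x)"
        using x by (simp add: sum_assoc)
      have "lam (inv x) x \<in> I"
        using x lam by simp
      from I_neg[OF this] show ?thesis
        unfolding eq[symmetric] .
    qed
  qed
  have circ_normal: "I \<lhd> B"
  proof (rule circ.normalI[OF circ_sub], rule ballI)
    fix b assume b: "b \<in> carrier B"
    then show "I #> b = b <# I"
      using normal.coset_eq[OF add_normal] by (simp add: rcos lcos)
  qed
  have "lam b ` I = I" if b: "b \<in> carrier B" for b
  proof
    show "lam b ` I \<subseteq> I"
      using b lam by auto
    show "I \<subseteq> lam b ` I"
    proof
      fix y assume "y \<in> I"
      then show "y \<in> lam b ` I"
        using b lam by (intro image_eqI[of _ _ "lam (inv b) y"]) simp_all
    qed
  qed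
  then show "brace_ideal I B"
    unfolding brace_ideal_def using sub add_normal circ_normal by blast
  show "rcosets\<^bsub>add_monoid B\<^esub> I = rcosets I"
    by (simp add: RCOSETS_def rcos)
qed

text \<open>
  The largest ideal contained in \<open>A\<close>. Only compositions in this one order are required to map into
  \<open>A\<close>, because such compositions already form a group of automorphisms.
\<close>

definition brace_core :: "'a set \<Rightarrow> 'a set" where
  "brace_core A = {y \<in> carrier B.
     \<forall>z\<in>carrier B. \<forall>b\<in>carrier B. \<forall>a\<in>carrier B. inner z (rho b (lam a y)) \<in> A}"

lemma brace_core_subset: "brace_core A \<subseteq> A"
proof
  fix y assume y: "y \<in> brace_core A"
  then have "inner \<zero> (rho \<one> (lam \<one> y)) \<in> A"
    unfolding brace_core_def using circ.one_closed zero_mem by blast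
  then show "y \<in> A"
    using y by (simp add: brace_core_def)
qed

lemma inner_rho_lam_sum:
  assumes "z \<in> carrier B" "b \<in> carrier B" "a \<in> carrier B" "x \<in> carrier B" "y \<in> carrier B"
  shows "inner z (rho b (lam a (x \<oplus> y))) = inner z (rho b (lam a x)) \<oplus> inner z (rho b (lam a y))"
  using assms by (simp add: inner_sum rho_sum lam_sum)

lemma subgroup_brace_core:
  assumes A: "subgroup A (add_monoid B)"
  shows "subgroup (brace_core A) (add_monoid B)"
proof (rule add.subgroupI)
  show "brace_core A \<subseteq> carrier (add_monoid B)"
    by (auto simp: brace_core_def)
  have hom: "group_hom (add_monoid B) (add_monoid B) (\<lambda>y. inner z (rho b (lam a y)))"
    if "z \<in> carrier B" "b \<in> carrier B" "a \<in> carrier B" for z b a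
    using that by (intro additive_hom) (simp_all add: inner_rho_lam_sum)
  have "\<zero> \<in> brace_core A"
    using group_hom.hom_one[OF hom] subgroup.one_closed[OF A] by (simp add: brace_core_def)
  then show "brace_core A \<noteq> {}"
    by blast
  show "inv\<^bsub>add_monoid B\<^esub> x \<in> brace_core A" if "x \<in> brace_core A" for x
    using that group_hom.hom_inv[OF hom] subgroup.m_inv_closed[OF A] add.inv_closed
    by (simp add: brace_core_def)
  show "x \<otimes>\<^bsub>add_monoid B\<^esub> y \<in> brace_core A" if "x \<in> brace_core A" "y \<in> brace_core A" for x y
    using that subgroup.m_closed[OF A] by (simp add: brace_core_def inner_rho_lam_sum)
qed

lemma brace_core_lam:
  assumes "c \<in> carrier B" "y \<in> brace_core A"
  shows "lam c y \<in> brace_core A"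
  using assms by (simp add: brace_core_def flip: lam_circ)

lemma brace_core_inner:
  assumes "c \<in> carrier B" "y \<in> brace_core A"
  shows "inner c y \<in> brace_core A"
  using assms by (simp add: brace_core_def lam_inner rho_inner inner_comp)

lemma brace_core_rho:
  assumes c: "c \<in> carrier B" and y: "y \<in> brace_core A"
  shows "rho c y \<in> brace_core A"
proof -
  have [simp]: "c \<in> carrier B" "y \<in> carrier B"
    using c y by (simp_all add: brace_core_def)
  have "inner z (rho b (lam a (rho c y))) \<in> A"
    if [simp]: "z \<in> carrier B" "b \<in> carrier B" "a \<in> carrier B" for z b a
  proof -
    define w where "w = \<ominus> a \<oplus> rho c a"
    have [simp]: "w \<in> carrier B"
      by (simp add: w_def)
    have "lam a (rho c y) = inner (\<ominus> a) (inner a (lam a (rho c y)))"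
      by simp
    also have "\<dots> = inner w (rho c (lam a y))"
      by (simp add: w_def inner_comp flip: inner_rho_lam)
    finally have "inner z (rho b (lam a (rho c y))) = inner (z \<oplus> rho b w) (rho (c \<otimes> b) (lam a y))"
      by (simp add: rho_inner inner_comp rho_circ)
    then show ?thesis
      using y by (simp add: brace_core_def)
  qed
  then show ?thesis
    by (simp add: brace_core_def)
qed

section \<open>Finiteness of the index\<close>

text \<open>
  Factors of \<open>a\<close>, \<open>b\<close> and \<open>z\<close> that lie in \<open>A\<close> can be moved to the outside of
  \<open>inner z \<circ> rho b \<circ> lam a\<close>, where they map \<open>A\<close> into itself. Moving them changes the
  conjugating element in an uncontrolled way, so \<open>a\<close> and \<open>b\<close> are reduced to \<open>S\<close> and \<open>T\<close> with an
  arbitrary conjugation left over, which is reduced to \<open>R\<close> separately.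
\<close>

lemma brace_core_finite_conditions:
  assumes A: "sub_skew_brace A B"
    and R: "R \<subseteq> carrier B" "\<And>z. z \<in> carrier B \<Longrightarrow> \<exists>h\<in>A. \<exists>r\<in>R. z = h \<oplus> r"
    and S: "S \<subseteq> carrier B" "\<And>a. a \<in> carrier B \<Longrightarrow> \<exists>h\<in>A. \<exists>s\<in>S. a = h \<otimes> s"
    and T: "T \<subseteq> carrier B" "\<And>b. b \<in> carrier B \<Longrightarrow> \<exists>h\<in>A. \<exists>t\<in>T. b = t \<otimes> h"
  shows "brace_core A = {y \<in> carrier B. \<forall>r\<in>R. \<forall>t\<in>T. \<forall>s\<in>S. inner r (rho t (lam s y)) \<in> A}"
proof
  show "brace_core A \<subseteq> {y \<in> carrier B. \<forall>r\<in>R. \<forall>t\<in>T. \<forall>s\<in>S. inner r (rho t (lam s y)) \<in> A}"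
    using R(1) S(1) T(1) unfolding brace_core_def by blast
next
  have add_A: "subgroup A (add_monoid B)" and circ_A: "subgroup A B"
    using A by (auto simp: sub_skew_brace_def)
  have [simp]: "h \<in> carrier B" if "h \<in> A" for h
    using subgroup.mem_carrier[OF circ_A that] .
  have A_sum: "x \<oplus> y \<in> A" if "x \<in> A" "y \<in> A" for x y
    using subgroup.m_closed[OF add_A that] by simp
  have A_neg: "\<ominus> x \<in> A" if "x \<in> A" for x
    using subgroup.m_inv_closed[OF add_A that] by (simp add: a_inv_def)
  have A_circ: "x \<otimes> y \<in> A" if "x \<in> A" "y \<in> A" for x y
    using subgroup.m_closed[OF circ_A that] .
  have A_lam: "lam h x \<in> A" and A_rho: "rho h x \<in> A" and A_inner: "inner h x \<in> A"
    if "h \<in> A" "x \<in> A" for h x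
    using that by (simp_all add: brace_lambda_def rho_def inner_def a_minus_def A_sum A_neg A_circ)
  show "{y \<in> carrier B. \<forall>r\<in>R. \<forall>t\<in>T. \<forall>s\<in>S. inner r (rho t (lam s y)) \<in> A} \<subseteq> brace_core A"
  proof
    fix y assume y': "y \<in> {y \<in> carrier B. \<forall>r\<in>R. \<forall>t\<in>T. \<forall>s\<in>S. inner r (rho t (lam s y)) \<in> A}"
    then have y: "y \<in> carrier B"
      by simp
    have key: "inner z (rho t (lam s y)) \<in> A" if z: "z \<in> carrier B" and st: "s \<in> S" "t \<in> T" for z s t
    proof -
      obtain h r where hr: "h \<in> A" "r \<in> R" "z = h \<oplus> r"
        using R(2)[OF z] by blast
      have [simp]: "r \<in> carrier B" "s \<in> carrier B" "t \<in> carrier B"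
        using hr(2) st R(1) S(1) T(1) by auto
      have "inner z (rho t (lam s y)) = inner h (inner r (rho t (lam s y)))"
        using hr(1) y by (simp add: hr(3) inner_comp)
      then show ?thesis
        using y' hr st A_inner by simp
    qed
    have "inner z (rho b (lam a y)) \<in> A"
      if [simp]: "z \<in> carrier B" "b \<in> carrier B" "a \<in> carrier B" for z b a
    proof -
      obtain h s where hs: "h \<in> A" "s \<in> S" "a = h \<otimes> s"
        using S(2)[OF \<open>a \<in> carrier B\<close>] by blast
      obtain k t where kt: "k \<in> A" "t \<in> T" "b = t \<otimes> k"
        using T(2)[OF \<open>b \<in> carrier B\<close>] by blast
      have [simp]: "s \<in> carrier B" "t \<in> carrier B" "h \<in> carrier B" "k \<in> carrier B" "y \<in> carrier B"
        using hs kt S(1) T(1) y by auto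
      define u where "u = rho t (lam s y)"
      define w where "w = \<ominus> (rho t h) \<oplus> h"
      have [simp]: "u \<in> carrier B" "w \<in> carrier B"
        by (simp_all add: u_def w_def)
      have "rho b (lam a y) = rho k (rho t (lam h (lam s y)))"
        by (simp add: hs(3) kt(3) lam_circ rho_circ)
      also have "\<dots> = rho k (inner w (lam h u))"
        by (simp add: u_def w_def rho_lam)
      finally have 1: "inner z (rho b (lam a y)) = inner z (rho k (inner w (lam h u)))"
        by simp
      \<comment> \<open>pull \<open>rho k\<close> and then \<open>lam h\<close> out through the conjugations, using their inverses\<close>
      define z1 where "z1 = rho (inv k) z \<oplus> w"
      define z2 where "z2 = lam (inv h) z1"
      have [simp]: "z1 \<in> carrier B" "z2 \<in> carrier B"
        by (simp_all add: z1_def z2_def)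
      have "rho k (lam h (inner z2 u)) = rho k (inner z1 (lam h u))"
        by (simp add: z2_def lam_inner)
      also have "\<dots> = rho k (inner (rho (inv k) z) (inner w (lam h u)))"
        by (simp add: z1_def inner_comp)
      also have "\<dots> = inner z (rho k (inner w (lam h u)))"
        by (simp add: rho_inner)
      finally have "inner z (rho b (lam a y)) = rho k (lam h (inner z2 u))"
        using 1 by simp
      moreover have "inner z2 u \<in> A"
        unfolding u_def by (rule key) (simp_all add: hs kt)
      ultimately show ?thesis
        using A_lam A_rho hs(1) kt(1) by simp
    qed
    then show "y \<in> brace_core A"
      using y by (simp add: brace_core_def)
  qed
qed

lemma finite_rcosets_brace_core:
  assumes A: "sub_skew_brace A B"
    and fin_add: "finite (rcosets\<^bsub>add_monoid B\<^esub> A)" and fin_circ: "finite (rcosets A)"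
  shows "finite (rcosets\<^bsub>add_monoid B\<^esub> (brace_core A))"
proof -
  have add_A: "subgroup A (add_monoid B)" and circ_A: "subgroup A B"
    using A by (auto simp: sub_skew_brace_def)
  obtain R where R: "finite R" "R \<subseteq> carrier B" "\<And>z. z \<in> carrier B \<Longrightarrow> \<exists>h\<in>A. \<exists>r\<in>R. z = h \<oplus> r"
    using add.finite_transversal[OF add_A fin_add] by auto
  obtain S where S: "finite S" "S \<subseteq> carrier B" "\<And>a. a \<in> carrier B \<Longrightarrow> \<exists>h\<in>A. \<exists>s\<in>S. a = h \<otimes> s"
    using circ.finite_transversal[OF circ_A fin_circ] by blast
  \<comment> \<open>inversion exchanges right and left cosets\<close>
  define T where "T = m_inv B ` S"
  have T: "finite T" "T \<subseteq> carrier B"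
    using S by (auto simp: T_def)
  have T_cover: "\<exists>h\<in>A. \<exists>t\<in>T. b = t \<otimes> h" if b: "b \<in> carrier B" for b
  proof -
    obtain h s where hs: "h \<in> A" "s \<in> S" "inv b = h \<otimes> s"
      using S(3)[of "inv b"] b by auto
    have "h \<in> carrier B" "s \<in> carrier B"
      using hs S(2) subgroup.mem_carrier[OF circ_A] by auto
    then have "b = inv s \<otimes> inv h"
      using hs(3) b by (metis circ.inv_inv circ.inv_mult_group)
    then show ?thesis
      using hs subgroup.m_inv_closed[OF circ_A] by (auto simp: T_def)
  qed
  define \<phi> where "\<phi> = (\<lambda>(r, t, s) y. inner r (rho t (lam s y)))"
  show ?thesis
  proof (rule add.finite_rcosets_INT_vimage[where K = "R \<times> T \<times> S" and \<phi> = \<phi>, OF add_A fin_add])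
    show "finite (R \<times> T \<times> S)"
      using R S T by simp
    show "\<phi> k \<in> hom (add_monoid B) (add_monoid B)" if "k \<in> R \<times> T \<times> S" for k
      using that R(2) S(2) T(2) by (auto simp: \<phi>_def hom_def inner_rho_lam_sum subset_iff)
    have "brace_core A = {y \<in> carrier B. \<forall>r\<in>R. \<forall>t\<in>T. \<forall>s\<in>S. inner r (rho t (lam s y)) \<in> A}"
      by (rule brace_core_finite_conditions[OF A]; fact)
    then show "brace_core A = {y \<in> carrier (add_monoid B). \<forall>k\<in>R \<times> T \<times> S. \<phi> k y \<in> A}"
      by (auto simp: \<phi>_def)
    show "subgroup (brace_core A) (add_monoid B)"
      by (rule subgroup_brace_core[OF add_A])
  qed
qed

end

theorem corollary3p5:
  fixes B :: "('a, 'm) ring_scheme" and A :: "'a set"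
  assumes "two_sided_skew_brace B"
    and "sub_skew_brace A B"
    and "finite_index A B"
  shows "\<exists>I. brace_ideal I B \<and> finite_index I B \<and> I \<subseteq> A"
proof -
  interpret two_sided_skew_brace B
    by (rule assms(1))
  have add_A: "subgroup A (add_monoid B)"
    using assms(2) by (simp add: sub_skew_brace_def)
  have fin: "finite (rcosets\<^bsub>add_monoid B\<^esub> A)" "finite (rcosets\<^bsub>B\<^esub> A)"
    using assms(3) by (auto simp: finite_index_def intro: card_ge_0_finite)
  let ?I = "brace_core A"
  note I = brace_idealI[OF subgroup_brace_core[OF add_A] brace_core_lam brace_core_rho
      brace_core_inner]
  have "rcosets\<^bsub>add_monoid B\<^esub> ?I \<noteq> {}"
    using zero_mem by (auto simp: RCOSETS_def)
  then have "card (rcosets\<^bsub>add_monoid B\<^esub> ?I) > 0"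
    using finite_rcosets_brace_core[OF assms(2) fin] by (simp add: card_gt_0_iff)
  then have "finite_index ?I B"
    unfolding finite_index_def using I(2) by auto
  then show ?thesis
    using I(1) brace_core_subset by blast
qed

end
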